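(* There exists a sequence of polynomials $\mathcal P_n$, $n=1,2,\dots$, with $\mathcal P_n$ of degree $n$, $\mathcal P_1=x$ and $\mathcal P_2=x^2-2x+2$, such that for every $n\ge1$ $$\mathcal P_{n+1}''\mathcal P_n-2\mathcal P_{n+1}'\mathcal P_n'+\mathcal P_{n+1}\mathcal P_n''+n\,\mathcal P_{n+1}'\mathcal P_n-(n+1)\mathcal P_{n+1}\mathcal P_n'=0 .$$ Moreover, up to the constant factor $c_n=\big[(n-1)!\prod_{1\le i<j\le n-1}(j-i)\big]^{-1}$, these polynomials can be written as $$\mathcal P_n=c_n\exp\Big(-\frac{n(n-1)x}{2}\Big)W(\omega_1,\dots,\omega_n),$$ where $W$ denotes the Wronskian, $\omega_j=(x-a_j)\exp((j-1)x)$, and $a_1=0$, $a_{j+1}=a_j+\frac2j$. *)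

theory Defs
  imports "HOL-Analysis.Analysis" "HOL-Computational_Algebra.Polynomial" "Jordan_Normal_Form.Determinant"
begin

definition wronskian :: "nat \<Rightarrow> (nat \<Rightarrow> real \<Rightarrow> real) \<Rightarrow> real \<Rightarrow> real" where
  "wronskian n f x = det (mat n n (\<lambda>(i, j). (deriv ^^ i) (f (j + 1)) x))"

(* a_1 = 0, a_{j+1} = a_j + 2/j  (a_coef 0 is an unused junk value) *)
fun a_coef :: "nat \<Rightarrow> real" where
  "a_coef 0 = 0"
| "a_coef (Suc 0) = 0"
| "a_coef (Suc (Suc j)) = a_coef (Suc j) + 2 / real (Suc j)"

definition omega :: "nat \<Rightarrow> real \<Rightarrow> real" where
  "omega j x = (x - a_coef j) * exp (real (j - 1) * x)"

definition c_const :: "nat \<Rightarrow> real" where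
  "c_const n = 1 / (fact (n - 1) * (\<Prod>j\<in>{1..n-1}. \<Prod>i\<in>{1..<j}. real (j - i)))"

end

theory Submission
  imports Defs "HOL-Computational_Algebra.Formal_Laurent_Series"
begin

text \<open>
  Write \<open>D\<close> for the derivative. The operator \<open>h\<^sub>0 = e\<^sup>-\<^sup>x D\<^sup>2\<close> satisfies \<open>h\<^sub>0 \<omega>\<^sub>1 = 0\<close> and
  \<open>h\<^sub>0 \<omega>\<^sub>j\<^sub>+\<^sub>1 = j\<^sup>2 \<omega>\<^sub>j\<close>; this is exactly what the choice \<open>a\<^sub>j\<^sub>+\<^sub>1 = a\<^sub>j + 2/j\<close> achieves. Hence the
  span of \<open>\<omega>\<^sub>1, \<dots>, \<omega>\<^sub>n\<close> is \<open>h\<^sub>0\<close>-invariant, and the monic operator \<open>L\<^sub>n\<close> of order \<open>n\<close> with this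
  kernel intertwines \<open>h\<^sub>0\<close> with an operator \<open>h\<^sub>n\<close>. Factoring \<open>L\<^sub>n\<close> into first-order operators
  (Darboux transformations) gives \<open>h\<^sub>n = e\<^sup>-\<^sup>x (D\<^sup>2 - n D + 2 (log P\<^sub>n)'' - (log P\<^sub>n)')\<close>. The function
  \<open>\<psi> = L\<^sub>n \<omega>\<^sub>n\<^sub>+\<^sub>1 = W\<^sub>n\<^sub>+\<^sub>1 / W\<^sub>n\<close>, a constant multiple of \<open>e\<^sup>n\<^sup>x P\<^sub>n\<^sub>+\<^sub>1 / P\<^sub>n\<close>, satisfies
  \<open>h\<^sub>n \<psi> = L\<^sub>n h\<^sub>0 \<omega>\<^sub>n\<^sub>+\<^sub>1 = n\<^sup>2 L\<^sub>n \<omega>\<^sub>n = 0\<close>, and this is the bilinear equation. The divisions are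
  carried out in the field of formal Laurent series, so that zeros of the Wronskians do no harm.
\<close>

hide_const (open) module.smult

section \<open>Determinants: Vandermonde matrices and matrices of linear polynomials\<close>

lemma det_scale_columns:
  fixes q :: "nat \<Rightarrow> nat \<Rightarrow> 'a :: comm_ring_1"
  shows "det (mat n n (\<lambda>(i, j). q i j * c j)) =
    det (mat n n (\<lambda>(i, j). q i j)) * (\<Prod>j<n. c j)"
proof -
  let ?C = "mat n n (\<lambda>(i, j). if i = j then c j else 0)"
  have "mat n n (\<lambda>(i, j). q i j * c j) = mat n n (\<lambda>(i, j). q i j) * ?C"
    by (rule eq_matI) (auto simp: scalar_prod_def if_distrib cong: if_cong)
  moreover have "det ?C = (\<Prod>j<n. c j)"
    by (subst det_lower_triangular[of n])
       (auto simp: prod_list_diag_prod atLeast0LessThan intro!: prod.cong)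
  ultimately show ?thesis
    by (simp add: det_mult[of _ n])
qed

text \<open>A nonzero kernel vector of the transpose would hold the coefficients of a nonzero
  polynomial of degree below \<open>n\<close> with the \<open>n\<close> roots 0, ..., n - 1.\<close>

lemma det_powers_nonzero:
  "det (mat n n (\<lambda>(i, j). real j ^ i)) \<noteq> 0"
proof
  let ?V = "mat n n (\<lambda>(i, j). real j ^ i)"
  assume "det ?V = 0"
  then have "det (transpose_mat ?V) = 0"
    by (subst det_transpose[of _ n]) auto
  then obtain v where v: "v \<in> carrier_vec n" "v \<noteq> 0\<^sub>v n" "transpose_mat ?V *\<^sub>v v = 0\<^sub>v n"
    using det_0_iff_vec_prod_zero[of "transpose_mat ?V" n] by auto
  define p where "p = (\<Sum>i<n. monom (vec_index v i) i)"
  have coeff: "coeff p i = vec_index v i" if "i < n" for i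
    using that by (simp add: p_def coeff_sum if_distrib cong: if_cong)
  have root: "poly p (real j) = 0" if "j < n" for j
  proof -
    have "vec_index (transpose_mat ?V *\<^sub>v v) j = (\<Sum>i<n. real j ^ i * vec_index v i)"
      using that v(1) by (auto simp: scalar_prod_def atLeast0LessThan intro!: sum.cong)
    then show ?thesis
      using that v(3) by (simp add: p_def poly_sum poly_monom mult.commute)
  qed
  have "p = 0"
  proof (rule ccontr)
    assume "p \<noteq> 0"
    have "n = card (real ` {..<n})"
      by (simp add: card_image)
    also have "\<dots> \<le> card {x. poly p x = 0}"
      using \<open>p \<noteq> 0\<close> root by (intro card_mono poly_roots_finite) auto
    also have "\<dots> \<le> degree p"
      by (rule card_poly_roots_bound[OF \<open>p \<noteq> 0\<close>])
    finally have "n \<le> degree p" .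
    moreover have "coeff p (degree p) = 0" if "n \<le> degree p"
      using that by (simp add: p_def coeff_sum)
    ultimately show False
      using \<open>p \<noteq> 0\<close> by simp
  qed
  with coeff v show False
    by auto
qed

lemma degree_prod_le_card:
  assumes "finite S" "\<And>i. i \<in> S \<Longrightarrow> degree (f i) \<le> 1"
  shows "degree (\<Prod>i\<in>S. f i) \<le> card S"
  using degree_prod_sum_le[OF assms(1), of f] sum_mono[of S "degree \<circ> f" "\<lambda>_. 1"] assms(2)
  by fastforce

lemma coeff_prod_card:
  fixes f :: "'b \<Rightarrow> 'a :: comm_ring_1 poly"
  assumes "finite S" "\<And>i. i \<in> S \<Longrightarrow> degree (f i) \<le> 1"
  shows "coeff (\<Prod>i\<in>S. f i) (card S) = (\<Prod>i\<in>S. coeff (f i) 1)"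
  using assms
proof (induction S rule: finite_induct)
  case (insert a S)
  let ?q = "\<Prod>i\<in>S. f i"
  have f: "f a = [:coeff (f a) 0, coeff (f a) 1:]"
    using insert.prems[of a] by (intro poly_eqI) (auto simp: coeff_pCons coeff_eq_0 split: nat.split)
  have "degree ?q \<le> card S"
    using insert by (intro degree_prod_le_card) auto
  then have "coeff ?q (Suc (card S)) = 0"
    by (simp add: coeff_eq_0)
  moreover have "coeff (f a * ?q) (Suc (card S)) =
      coeff (f a) 0 * coeff ?q (Suc (card S)) + coeff (f a) 1 * coeff ?q (card S)"
    by (subst f) simp
  ultimately show ?case
    using insert by simp
qed simp

text \<open>Each term of the Leibniz formula is, up to sign, a product of \<open>n\<close> factors
  of degree at most 1, so its coefficient at \<open>n\<close> is the product of their linear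
  coefficients.\<close>

lemma
  fixes q :: "nat \<Rightarrow> nat \<Rightarrow> 'a :: comm_ring_1 poly"
  assumes "\<And>i j. degree (q i j) \<le> 1"
  shows degree_det_linear_le: "degree (det (mat n n (\<lambda>(i, j). q i j))) \<le> n"
    and coeff_det_linear: "coeff (det (mat n n (\<lambda>(i, j). q i j))) n =
      det (mat n n (\<lambda>(i, j). coeff (q i j) 1))"
proof -
  have perm: "p i < n" if "p permutes {0..<n}" "i < n" for p i
    using that permutes_in_image[of p "{0..<n}" i] by auto
  have det: "det (mat n n (\<lambda>(i, j). q i j)) =
      (\<Sum>p | p permutes {0..<n}. signof p * (\<Prod>i = 0..<n. q i (p i)))"
    by (auto simp: Determinant.det_def perm intro!: sum.cong prod.cong)
  show "degree (det (mat n n (\<lambda>(i, j). q i j))) \<le> n"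
    unfolding det
  proof (rule degree_sum_le)
    fix p :: "nat \<Rightarrow> nat"
    have "degree (\<Prod>i = 0..<n. q i (p i)) \<le> n"
      using degree_prod_le_card[of "{0..<n}" "\<lambda>i. q i (p i)"] assms by simp
    then show "degree (signof p * (\<Prod>i = 0..<n. q i (p i))) \<le> n"
      by (simp add: sign_def)
  qed (simp add: finite_permutations)
  have "coeff (signof p * (\<Prod>i = 0..<n. q i (p i))) n = signof p * (\<Prod>i = 0..<n. coeff (q i (p i)) 1)"
    for p :: "nat \<Rightarrow> nat"
    using coeff_prod_card[of "{0..<n}" "\<lambda>i. q i (p i)"] assms by (simp add: sign_def)
  then show "coeff (det (mat n n (\<lambda>(i, j). q i j))) n =
      det (mat n n (\<lambda>(i, j). coeff (q i j) 1))"
    unfolding det by (auto simp: Determinant.det_def perm coeff_sum intro!: sum.cong prod.cong)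
qed

section \<open>Derivations on a field and Wronskians\<close>

locale differential_field =
  fixes d :: "'a :: field \<Rightarrow> 'a"
  assumes d_add: "d (x + y) = d x + d y"
    and d_mult: "d (x * y) = d x * y + x * d y"
begin

lemma d_0 [simp]: "d 0 = 0"
  using d_add[of 0 0] by (metis add.right_neutral add_left_cancel)

lemma d_1 [simp]: "d 1 = 0"
  using d_mult[of 1 1] by (metis add.right_neutral add_left_cancel mult_1 mult_1_right)

lemma d_minus: "d (- x) = - d x"
  using d_add[of x "- x"] by (simp add: eq_neg_iff_add_eq_0 add.commute)

lemma d_diff: "d (x - y) = d x - d y"
  using d_add[of x "- y"] by (simp add: d_minus)

lemma d_sum: "d (\<Sum>i\<in>A. f i) = (\<Sum>i\<in>A. d (f i))"
  by (induction A rule: infinite_finite_induct) (auto simp: d_add)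

lemma d_of_nat [simp]: "d (of_nat n) = 0"
  by (induction n) (auto simp: d_add)

lemma d_numeral [simp]: "d (numeral k) = 0"
  using d_of_nat[of "numeral k"] by simp

lemma d_power: "d (x ^ n) = of_nat n * x ^ (n - 1) * d x"
proof (induction n)
  case (Suc n)
  then show ?case
    by (cases n) (simp_all add: d_mult algebra_simps)
qed simp

lemma d_power_exp:
  assumes "d e = e"
  shows "d (e ^ n) = of_nat n * e ^ n"
  by (cases n) (simp_all add: d_power assms mult_ac del: power_Suc, simp add: mult_ac)

lemma d_funpow_0 [simp]: "(d ^^ i) 0 = 0"
  by (induction i) auto

lemmas d_simps = d_add d_diff d_minus d_mult

definition wr :: "nat \<Rightarrow> (nat \<Rightarrow> 'a) \<Rightarrow> 'a" where
  "wr n f = det (mat n n (\<lambda>(i, j). (d ^^ i) (f j)))"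

text \<open>The coefficients \<open>t\<close> are the same for all \<open>y\<close> and the top one
  is 1, so in \<open>wr_reduce\<close> they form the rows of a unitriangular matrix.\<close>

lemma d_funpow_first_order:
  "\<exists>t. t (Suc i) = 1 \<and> (\<forall>y. (d ^^ i) (d y - g * y) = (\<Sum>k\<le>Suc i. t k * (d ^^ k) y))"
proof (induction i)
  case 0
  show ?case
    by (rule exI[of _ "\<lambda>k. if k = 0 then - g else 1"]) simp
next
  case (Suc i)
  then obtain t where t: "t (Suc i) = 1"
    "\<And>y. (d ^^ i) (d y - g * y) = (\<Sum>k\<le>Suc i. t k * (d ^^ k) y)"
    by blast
  \<comment> \<open>The Leibniz rule for \<open>t k * (d ^^ k) y\<close>. The first guard is there
    because \<open>t\<close> is unconstrained beyond \<open>Suc i\<close>.\<close>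
  define t' where "t' k = (if k \<le> Suc i then d (t k) else 0) + (if k = 0 then 0 else t (k - 1))" for k
  have "(d ^^ Suc i) (d y - g * y) = (\<Sum>k\<le>Suc (Suc i). t' k * (d ^^ k) y)" for y
  proof -
    have "(d ^^ Suc i) (d y - g * y) =
        (\<Sum>k\<le>Suc i. d (t k) * (d ^^ k) y) + (\<Sum>k\<le>Suc i. t k * (d ^^ Suc k) y)"
      using t(2)[of y] by (simp add: d_sum d_mult sum.distrib del: sum.atMost_Suc)
    also have "(\<Sum>k\<le>Suc i. d (t k) * (d ^^ k) y) =
        (\<Sum>k\<le>Suc (Suc i). (if k \<le> Suc i then d (t k) else 0) * (d ^^ k) y)"
      by (simp del: funpow.simps)
    also have "(\<Sum>k\<le>Suc i. t k * (d ^^ Suc k) y) =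
        (\<Sum>k\<le>Suc (Suc i). (if k = 0 then 0 else t (k - 1)) * (d ^^ k) y)"
      by (subst (2) sum.atMost_Suc_shift) simp
    finally show ?thesis
      by (simp add: t'_def distrib_right sum.distrib del: sum.atMost_Suc funpow.simps)
  qed
  moreover have "t' (Suc (Suc i)) = 1"
    using t(1) by (simp add: t'_def)
  ultimately show ?case
    by blast
qed

text \<open>Row operations of determinant 1 turn the rows below the top one into the derivatives of
  \<open>d y - g * y\<close>. This vanishes at \<open>y = f 0\<close>, so the first column keeps
  only its top entry.\<close>

lemma wr_reduce:
  assumes "d (f 0) = g * f 0"
  shows "wr (Suc n) f = f 0 * wr n (\<lambda>j. d (f (Suc j)) - g * f (Suc j))"
proof -
  obtain t where t: "\<And>i. t i (Suc i) = 1"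
    "\<And>i y. (d ^^ i) (d y - g * y) = (\<Sum>k\<le>Suc i. t i k * (d ^^ k) y)"
    using d_funpow_first_order[of _ g] by metis
  define T where "T = mat (Suc n) (Suc n)
    (\<lambda>(i, k). if i = 0 then (if k = 0 then 1 else 0) else if k \<le> i then t (i - 1) k else 0)"
  define F where "F = mat (Suc n) (Suc n) (\<lambda>(i, j). (d ^^ i) (f j))"
  define R where "R = mat (Suc n) (Suc n)
    (\<lambda>(i, j). if i = 0 then f j else (d ^^ (i - 1)) (d (f j) - g * f j))"
  have carrier: "T \<in> carrier_mat (Suc n) (Suc n)" "F \<in> carrier_mat (Suc n) (Suc n)"
    "R \<in> carrier_mat (Suc n) (Suc n)"
    by (auto simp: T_def F_def R_def)
  have "T * F = R"
  proof (rule eq_matI)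
    fix i j assume "i < dim_row R" "j < dim_col R"
    then have ij: "i < Suc n" "j < Suc n"
      by (auto simp: R_def)
    have "(T * F) $$ (i, j) = (\<Sum>k<Suc n. T $$ (i, k) * (d ^^ k) (f j))"
      using ij carrier by (auto simp: scalar_prod_def F_def T_def atLeast0LessThan intro!: sum.cong)
    also have "\<dots> = R $$ (i, j)"
    proof (cases i)
      case 0
      have "(\<Sum>k<Suc n. T $$ (i, k) * (d ^^ k) (f j)) = (\<Sum>k<Suc n. if k = 0 then f j else 0)"
        using 0 by (intro sum.cong) (auto simp: T_def)
      also have "\<dots> = f j"
        by (subst sum.delta) auto
      finally show ?thesis
        using 0 ij by (simp add: R_def)
    next
      case (Suc m)
      have "(\<Sum>k<Suc n. T $$ (i, k) * (d ^^ k) (f j)) = (\<Sum>k\<le>Suc m. t m k * (d ^^ k) (f j))"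
        using Suc ij by (intro sum.mono_neutral_cong_right) (auto simp: T_def)
      then show ?thesis
        using Suc ij t(2)[of m "f j"] by (simp add: R_def)
    qed
    finally show "(T * F) $$ (i, j) = R $$ (i, j)" .
  qed (use carrier in auto)
  moreover have "det T = 1"
  proof -
    have "det T = prod_list (diag_mat T)"
      using carrier by (intro det_lower_triangular[of "Suc n"]) (auto simp: T_def)
    also have "\<dots> = 1"
      unfolding prod_list_diag_prod
    proof (rule prod.neutral, rule ballI)
      fix i assume "i \<in> {0..<dim_row T}"
      then show "T $$ (i, i) = 1"
        using t(1)[of "i - 1"] by (cases i) (auto simp: T_def)
    qed
    finally show ?thesis .
  qed
  ultimately have "wr (Suc n) f = det R"
    using det_mult[OF carrier(1,2)] by (simp add: wr_def F_def)
  also have "\<dots> = (\<Sum>i<Suc n. R $$ (i, 0) * cofactor R i 0)"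
    using carrier by (intro laplace_expansion_column) auto
  also have "\<dots> = (\<Sum>i<Suc n. if i = 0 then f 0 * cofactor R 0 0 else 0)"
    using assms by (intro sum.cong) (auto simp: R_def)
  also have "\<dots> = f 0 * cofactor R 0 0"
    by (subst sum.delta) auto
  also have "cofactor R 0 0 = wr n (\<lambda>j. d (f (Suc j)) - g * f (Suc j))"
    unfolding cofactor_def wr_def
    by (auto simp: mat_delete_def R_def intro!: arg_cong[of _ _ det] eq_matI)
  finally show ?thesis .
qed


section \<open>Crum's iterated reduction of Wronskians\<close>

text \<open>\<open>crum f n j\<close> is \<open>L\<^sub>n (f j)\<close>, where \<open>L\<^sub>n\<close> is the monic operator of order \<open>n\<close> that annihilates
  \<open>f 0, \<dots>, f (n - 1)\<close>. When \<open>crum f n n = 0\<close> the junk value of the quotient is harmless: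
  the step is then plain differentiation, which still annihilates \<open>crum f n n\<close>.\<close>

fun crum :: "(nat \<Rightarrow> 'a) \<Rightarrow> nat \<Rightarrow> nat \<Rightarrow> 'a" where
  "crum f 0 j = f j"
| "crum f (Suc n) j = d (crum f n j) - d (crum f n n) / crum f n n * crum f n j"

declare crum.simps(2) [simp del]

lemma crum_eq_0: "j < n \<Longrightarrow> crum f n j = 0"
proof (induction n)
  case (Suc n)
  then show ?case
    by (cases "j = n") (auto simp: crum.simps(2))
qed simp

text \<open>Repeated \<open>wr_reduce\<close>: each application splits off one diagonal value and
  passes from \<open>crum f m\<close> to \<open>crum f (Suc m)\<close>.\<close>

lemma wr_crum: "wr n (\<lambda>j. crum f m (m + j)) = (\<Prod>k<n. crum f (m + k) (m + k))"
proof (induction n arbitrary: m)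
  case 0
  then show ?case
    by (simp add: wr_def)
next
  case (Suc n)
  have "wr (Suc n) (\<lambda>j. crum f m (m + j)) = crum f m m * wr n (\<lambda>j. crum f (Suc m) (Suc m + j))"
    by (subst wr_reduce[where g = "d (crum f m m) / crum f m m"]) (auto simp: crum.simps(2))
  also have "\<dots> = crum f m m * (\<Prod>k<n. crum f (m + Suc k) (m + Suc k))"
    by (simp only: Suc.IH) simp
  also have "\<dots> = (\<Prod>k<Suc n. crum f (m + k) (m + k))"
    by (simp add: prod.lessThan_Suc_shift del: prod.lessThan_Suc)
  finally show ?case .
qed

lemma wr_Suc: "wr (Suc n) f = wr n f * crum f n n"
  using wr_crum[of "Suc n" f 0] wr_crum[of n f 0] by simp

end

section \<open>The intertwining relation and the bilinear equation\<close>

text \<open>For \<open>j = 0\<close> the truncated index in \<open>f (j - 1)\<close> is harmless because of the factor \<open>j\<^sup>2\<close>.\<close>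

locale exponential_tower = differential_field d for d :: "'a :: field \<Rightarrow> 'a" +
  fixes e :: 'a and f :: "nat \<Rightarrow> 'a" and p :: "nat \<Rightarrow> 'a"
  assumes e_nonzero: "e \<noteq> 0"
    and d_e: "d e = e"
    and dd_f: "d (d (f j)) = (of_nat j)\<^sup>2 * e * f (j - 1)"
    and p_nonzero: "p n \<noteq> 0"
    and wr_f: "wr n f = p n * e ^ (\<Sum>j<n. j)"
begin

definition s :: "nat \<Rightarrow> 'a" where
  "s n = d (p n) / p n"

definition g :: "nat \<Rightarrow> 'a" where
  "g n = d (crum f n n) / crum f n n"

lemma p_0: "p 0 = 1"
  using wr_f[of 0] by (simp add: wr_def)

lemma p_Suc: "p (Suc n) * e ^ n = p n * crum f n n"
proof -
  have "(p (Suc n) * e ^ n) * e ^ (\<Sum>j<n. j) = (p n * crum f n n) * e ^ (\<Sum>j<n. j)"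
    using wr_Suc[of n f] wr_f[of n] wr_f[of "Suc n"] by (simp add: power_add mult_ac)
  then show ?thesis
    using e_nonzero by simp
qed

lemma crum_diag_nonzero: "crum f n n \<noteq> 0"
  using p_Suc[of n] p_nonzero[of "Suc n"] e_nonzero by auto

lemma d_p: "d (p n) = s n * p n"
  using p_nonzero by (simp add: s_def)

lemma d_crum_diag: "d (crum f n n) = g n * crum f n n"
  using crum_diag_nonzero by (simp add: g_def)

lemma s_Suc: "s (Suc n) = s n + g n - of_nat n"
proof -
  have "d (p (Suc n) * e ^ n) = (s (Suc n) + of_nat n) * (p (Suc n) * e ^ n)"
    by (simp add: d_mult d_p d_power_exp[OF d_e] algebra_simps)
  moreover have "d (p n * crum f n n) = (s n + g n) * (p n * crum f n n)"
    by (simp add: d_mult d_p d_crum_diag algebra_simps)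
  ultimately have "(s (Suc n) + of_nat n) * (p n * crum f n n) = (s n + g n) * (p n * crum f n n)"
    by (simp only: p_Suc)
  then have "s (Suc n) + of_nat n = s n + g n"
    using p_nonzero[of n] crum_diag_nonzero[of n] by simp
  then show ?thesis
    by (simp add: algebra_simps)
qed

text \<open>In terms of the logarithmic derivative \<open>g n\<close>, the second-order equation
  becomes a Riccati equation, which determines the potential \<open>v\<close>.\<close>

lemma potential_eq:
  assumes "d (d (crum f n n)) - of_nat n * d (crum f n n) + v * crum f n n = 0"
  shows "v = of_nat n * g n - d (g n) - (g n)\<^sup>2"
proof -
  have "(v - (of_nat n * g n - d (g n) - (g n)\<^sup>2)) * crum f n n = 0"
    using assms by (simp add: d_crum_diag d_mult algebra_simps power2_eq_square)
  then show ?thesis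
    using crum_diag_nonzero[of n] by simp
qed

text \<open>This is \<open>h\<^sub>n L\<^sub>n = L\<^sub>n h\<^sub>0\<close> applied to
  \<open>f j\<close> and multiplied by \<open>e\<close>. The case \<open>j = n\<close> yields the
  factorization \<open>(d - N + G) (d - G)\<close> of the operator; the induction step swaps the
  factors, with a shift by 1.\<close>

lemma crum_ode:
  "d (d (crum f n j)) - of_nat n * d (crum f n j) + (2 * d (s n) - s n) * crum f n j =
    (of_nat j)\<^sup>2 * e * crum f n (j - 1)"
proof (induction n arbitrary: j)
  case 0
  then show ?case
    by (simp add: s_def p_0 dd_f)
next
  case (Suc n)
  define v where "v = 2 * d (s n) - s n"
  define N where "N = (of_nat n :: 'a)"
  define G where "G = g n"
  define c where "c = (of_nat j :: 'a)\<^sup>2"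
  define y where "y = crum f n j"
  define z where "z = crum f n (j - 1)"
  have [simp]: "d N = 0" "d c = 0"
    by (simp_all add: N_def c_def power2_eq_square d_mult)
  \<comment> \<open>At \<open>j = n\<close> the right-hand side of the equation vanishes:
    \<open>crum f n\<close> annihilates \<open>f (n - 1)\<close>, and for \<open>n = 0\<close> the
    factor \<open>j\<^sup>2\<close> is 0.\<close>
  have "crum f n (n - 1) = 0 \<or> n = 0"
    by (cases n) (auto intro: crum_eq_0)
  then have "d (d (crum f n n)) - of_nat n * d (crum f n n) + v * crum f n n = 0"
    using Suc.IH[of n] by (auto simp: v_def)
  then have v: "v = N * G - d G - G\<^sup>2"
    unfolding N_def G_def by (rule potential_eq)
  have crum_Suc: "crum f (Suc n) i = d (crum f n i) - G * crum f n i" for i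
    by (simp add: crum.simps(2) G_def g_def)
  have v': "2 * d (s (Suc n)) - s (Suc n) = 2 * d G - G + N + v"
    by (simp add: s_Suc d_simps v_def N_def G_def algebra_simps)
  have ode: "d (d y) - N * d y + v * y = c * e * z"
    using Suc.IH[of j] by (simp add: N_def v_def y_def z_def c_def)
  have "d (d (d y) - N * d y + v * y) = d (c * e * z)"
    using ode by simp
  then have ode': "d (d (d y)) - N * d (d y) + d v * y + v * d y = c * e * z + c * e * d z"
    by (simp add: d_simps d_e algebra_simps)
  have dv: "d v = N * d G - d (d G) - 2 * G * d G"
    unfolding v by (simp add: d_simps power2_eq_square algebra_simps)
  \<comment> \<open>The operator identity \<open>(d - 1 - G) (d - N + G) (d - G) = (d - 1 - G) (d\<^sup>2 - N d + v)\<close>.\<close>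
  have "d (d (d y - G * y)) - (1 + N) * d (d y - G * y) + (2 * d G - G + N + v) * (d y - G * y) =
    (d (d (d y)) - N * d (d y) + d v * y + v * d y) - (1 + G) * (d (d y) - N * d y + v * y)"
    unfolding dv v by (simp add: d_simps power2_eq_square algebra_simps)
  \<comment> \<open>The extra -1 in \<open>d - 1 - G\<close> absorbs \<open>d e = e\<close>: applied
    to \<open>e * z\<close>, the operator gives \<open>e * (d z - G * z)\<close>.\<close>
  also have "\<dots> = c * e * (d z - G * z)"
    unfolding ode ode' by (simp add: algebra_simps)
  finally show ?case
    unfolding v' by (simp add: crum_Suc y_def z_def N_def c_def)
qed

theorem bilinear:
  "d (d (p (Suc n))) * p n - 2 * d (p (Suc n)) * d (p n) + p (Suc n) * d (d (p n))
    + of_nat n * d (p (Suc n)) * p n - of_nat (Suc n) * p (Suc n) * d (p n) = 0"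
proof -
  have "crum f n (n - 1) = 0 \<or> n = 0"
    by (cases n) (auto intro: crum_eq_0)
  then have "d (d (crum f n n)) - of_nat n * d (crum f n n) + (2 * d (s n) - s n) * crum f n n = 0"
    using crum_ode[of n n] by auto
  then have v: "2 * d (s n) - s n = of_nat n * g n - d (g n) - (g n)\<^sup>2"
    by (rule potential_eq)
  have g: "g n = s (Suc n) - s n + of_nat n"
    by (simp add: s_Suc)
  have riccati: "d (s (Suc n)) + d (s n) + (s (Suc n) - s n)\<^sup>2
      + of_nat n * s (Suc n) - of_nat (Suc n) * s n = 0"
    using v unfolding g by (simp add: d_simps power2_eq_square algebra_simps)
  \<comment> \<open>Each second derivative is (s' + s^2) p with s = p'/p, so the bilinear form is
    the Riccati expression times both polynomials.\<close>
  have "d (d (p (Suc n))) * p n - 2 * d (p (Suc n)) * d (p n) + p (Suc n) * d (d (p n))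
    + of_nat n * d (p (Suc n)) * p n - of_nat (Suc n) * p (Suc n) * d (p n) =
    (d (s (Suc n)) + d (s n) + (s (Suc n) - s n)\<^sup>2
      + of_nat n * s (Suc n) - of_nat (Suc n) * s n) * (p n * p (Suc n))"
    by (simp add: d_p d_mult power2_eq_square algebra_simps)
  then show ?thesis
    unfolding riccati by simp
qed

end

section \<open>The Wronskian as a polynomial times an exponential\<close>

text \<open>Differentiation of polynomials conjugated by \<open>e\<^sup>j\<^sup>x\<close>.\<close>

definition twisted_deriv :: "nat \<Rightarrow> real poly \<Rightarrow> real poly" where
  "twisted_deriv j p = pderiv p + smult (real j) p"

text \<open>The polynomial factor of the \<open>i\<close>-th derivative of
  \<open>omega (Suc j)\<close>: columns count from 0, so that \<open>j\<close> is also the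
  exponent.\<close>

definition entry :: "nat \<Rightarrow> nat \<Rightarrow> real poly" where
  "entry i j = (twisted_deriv j ^^ i) [:- a_coef (Suc j), 1:]"

definition entry_det :: "nat \<Rightarrow> real poly" where
  "entry_det n = det (mat n n (\<lambda>(i, j). entry i j))"

lemma degree_entry: "degree (entry i j) \<le> 1"
proof (induction i)
  case (Suc i)
  then show ?case
    by (auto simp: entry_def twisted_deriv_def degree_pderiv intro!: degree_add_le)
qed (simp add: entry_def)

lemma coeff_entry: "coeff (entry i j) 1 = real j ^ i"
proof (induction i)
  case (Suc i)
  have "coeff (entry i j) 2 = 0"
    using degree_entry[of i j] by (intro coeff_eq_0) auto
  with Suc show ?case
    by (simp add: entry_def twisted_deriv_def coeff_pderiv numeral_2_eq_2)
qed (simp add: entry_def)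

text \<open>The linear coefficients of the entries form the Vandermonde matrix of the nodes 0, ...,
  n - 1.\<close>

lemma coeff_entry_det: "coeff (entry_det n) n \<noteq> 0"
  using det_powers_nonzero[of n] coeff_det_linear[of entry n, OF degree_entry]
  by (simp only: entry_det_def coeff_entry not_False_eq_True)

lemma degree_entry_det: "degree (entry_det n) = n"
  using coeff_entry_det[of n] degree_det_linear_le[of entry n] degree_entry
  by (intro antisym le_degree) (auto simp: entry_det_def)

lemma entry_det_nonzero: "entry_det n \<noteq> 0"
  using coeff_entry_det[of n] by auto

lemma entry_det_1: "entry_det 1 = [:0, 1:]"
  by (simp add: entry_det_def det_single entry_def)

lemma entry_det_2: "entry_det 2 = [:2, -2, 1:]"
proof -
  have "entry_det 2 = entry 0 0 * entry 1 1 - entry 0 1 * entry 1 0"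
    unfolding entry_det_def
    by (subst laplace_expansion_column[of _ 2 0])
       (auto simp: numeral_2_eq_2 cofactor_def det_single mat_delete_def)
  then show ?thesis
    by (simp add: entry_def twisted_deriv_def pderiv_pCons numeral_2_eq_2)
qed

lemma deriv_funpow_omega:
  "(deriv ^^ i) (omega (Suc j)) = (\<lambda>x. poly (entry i j) x * exp (real j * x))"
proof (induction i)
  case 0
  show ?case
    by (auto simp: entry_def omega_def)
next
  case (Suc i)
  have "deriv (\<lambda>x. poly (entry i j) x * exp (real j * x)) x =
      poly (entry (Suc i) j) x * exp (real j * x)" for x
    by (rule DERIV_imp_deriv)
       (auto intro!: derivative_eq_intros simp: entry_def twisted_deriv_def algebra_simps)
  with Suc show ?case
    by auto
qed

lemma wronskian_omega:
  "wronskian n omega x = poly (entry_det n) x * exp (real n * (real n - 1) * x / 2)"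
proof -
  interpret eval: comm_ring_hom "\<lambda>p. poly p x"
    by unfold_locales auto
  have "wronskian n omega x =
      det (mat n n (\<lambda>(i, j). poly (entry i j) x * exp (real j * x)))"
    by (simp add: wronskian_def deriv_funpow_omega)
  also have "\<dots> = det (mat n n (\<lambda>(i, j). poly (entry i j) x)) * (\<Prod>j<n. exp (real j * x))"
    by (rule det_scale_columns)
  also have "mat n n (\<lambda>(i, j). poly (entry i j) x) =
      map_mat (\<lambda>p. poly p x) (mat n n (\<lambda>(i, j). entry i j))"
    by (rule eq_matI) auto
  also have "det \<dots> = poly (entry_det n) x"
    by (simp only: eval.hom_det entry_det_def)
  also have "(\<Prod>j<n. exp (real j * x)) = exp (real n * (real n - 1) * x / 2)"
  proof (induction n)
    case (Suc n)
    then show ?case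
      by (simp add: exp_add [symmetric] field_simps)
  qed simp
  finally show ?thesis .
qed

section \<open>Transfer to formal Laurent series\<close>

definition fls_of_poly :: "real poly \<Rightarrow> real fls" where
  "fls_of_poly p = fps_to_fls (fps_of_poly p)"

interpretation fls_of_poly: inj_comm_ring_hom fls_of_poly
  by unfold_locales
     (auto simp: fls_of_poly_def fps_of_poly_add fps_of_poly_mult fls_times_fps_to_fls
        simp flip: fps_of_poly_0)

interpretation fls: differential_field "fls_deriv :: real fls \<Rightarrow> real fls"
  by unfold_locales (auto simp: algebra_simps)

lemma fls_deriv_of_poly: "fls_deriv (fls_of_poly p) = fls_of_poly (pderiv p)"
  by (simp add: fls_of_poly_def fls_deriv_fps_to_fls fps_of_poly_pderiv)

definition fls_exp :: "real fls" where
  "fls_exp = fps_to_fls (fps_exp 1)"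

lemma fls_deriv_exp: "fls_deriv fls_exp = fls_exp"
  by (simp add: fls_exp_def fls_deriv_fps_to_fls)

lemma fls_of_poly_of_nat: "fls_of_poly (of_nat n) = of_nat n"
  by (induction n) (simp_all add: fls_of_poly.hom_add)

lemma fls_of_poly_smult_of_nat: "fls_of_poly (smult (real j) p) = of_nat j * fls_of_poly p"
proof -
  have "smult (real j) p = of_nat j * p"
    by (simp add: of_nat_poly)
  then show ?thesis
    by (simp only: fls_of_poly.hom_mult fls_of_poly_of_nat)
qed

lemma fls_deriv_poly_exp:
  "fls_deriv (fls_of_poly p * fls_exp ^ j) = fls_of_poly (twisted_deriv j p) * fls_exp ^ j"
  by (simp add: fls_deriv_of_poly fls.d_power_exp[OF fls_deriv_exp] twisted_deriv_def fls_of_poly_smult_of_nat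
      fls_of_poly.hom_add algebra_simps)

definition fls_omega :: "nat \<Rightarrow> real fls" where
  "fls_omega j = fls_of_poly [:- a_coef (Suc j), 1:] * fls_exp ^ j"

lemma fls_deriv_funpow_omega:
  "(fls_deriv ^^ i) (fls_omega j) = fls_of_poly (entry i j) * fls_exp ^ j"
  by (induction i) (simp_all add: entry_def fls_omega_def fls_deriv_poly_exp del: fls_deriv_mult)

lemma wr_fls_omega: "fls.wr n fls_omega = fls_of_poly (entry_det n) * fls_exp ^ (\<Sum>j<n. j)"
proof -
  have "fls.wr n fls_omega =
      det (mat n n (\<lambda>(i, j). fls_of_poly (entry i j))) * (\<Prod>j<n. fls_exp ^ j)"
    unfolding fls.wr_def fls_deriv_funpow_omega by (rule det_scale_columns)
  also have "mat n n (\<lambda>(i, j). fls_of_poly (entry i j)) =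
      map_mat fls_of_poly (mat n n (\<lambda>(i, j). entry i j))"
    by (rule eq_matI) auto
  also have "det \<dots> = fls_of_poly (entry_det n)"
    by (simp only: fls_of_poly.hom_det entry_det_def)
  finally show ?thesis
    by (simp add: power_sum)
qed

text \<open>The second derivative of (x - a) e^(jx) is j^2 (x - (a - 2/j)) e^(jx), and the recursion
  for \<open>a_coef\<close> makes a - 2/j the previous shift. For \<open>j = 0\<close> the function
  is linear.\<close>

lemma fls_deriv2_omega:
  "fls_deriv (fls_deriv (fls_omega j)) = (of_nat j)\<^sup>2 * fls_exp * fls_omega (j - 1)"
proof (cases j)
  case 0
  then show ?thesis
    by (simp add: fls_omega_def fls_deriv_of_poly pderiv_pCons)
next
  case (Suc m)
  have "entry 2 j = of_nat j * (of_nat j * [:- a_coef (Suc m), 1:])"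
    by (simp add: Suc entry_def twisted_deriv_def pderiv_pCons numeral_2_eq_2 of_nat_poly field_simps)
  then have "fls_of_poly (entry 2 j) = (of_nat j)\<^sup>2 * fls_of_poly [:- a_coef (Suc m), 1:]"
    by (simp only: fls_of_poly.hom_mult fls_of_poly_of_nat power2_eq_square mult.assoc)
  then show ?thesis
    using fls_deriv_funpow_omega[of 2 j] by (simp add: numeral_2_eq_2 fls_omega_def Suc mult_ac)
qed

interpretation tower: exponential_tower fls_deriv fls_exp fls_omega "\<lambda>n. fls_of_poly (entry_det n)"
  by unfold_locales
     (simp_all add: fls_deriv_exp fls_deriv2_omega wr_fls_omega entry_det_nonzero, simp add: fls_exp_def)

text \<open>Both sides are polynomials, so the identity in Laurent series comes back along the
  injective \<open>fls_of_poly\<close>.\<close>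

lemma bilinear_entry_det:
  "pderiv (pderiv (entry_det (n + 1))) * entry_det n
    - 2 * pderiv (entry_det (n + 1)) * pderiv (entry_det n)
    + entry_det (n + 1) * pderiv (pderiv (entry_det n))
    + of_nat n * pderiv (entry_det (n + 1)) * entry_det n
    - of_nat (n + 1) * entry_det (n + 1) * pderiv (entry_det n) = 0" (is "?B = 0")
proof -
  have two: "fls_of_poly 2 = 2"
    using fls_of_poly_of_nat[of 2] by simp
  have "fls_of_poly ?B = 0"
    using tower.bilinear[of n]
    by (simp only: fls_deriv_of_poly fls_of_poly.hom_add fls_of_poly.hom_minus
        fls_of_poly.hom_mult fls_of_poly_of_nat two Suc_eq_plus1)
  then show ?thesis
    by simp
qed

theorem theorem6p1:
  shows "\<exists>P :: nat \<Rightarrow> real poly.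
    (\<forall>n\<ge>1. degree (P n) = n) \<and>
    P 1 = [:0, 1:] \<and>
    P 2 = [:2, -2, 1:] \<and>
    (\<forall>n\<ge>1.
       pderiv (pderiv (P (n + 1))) * P n
       - 2 * pderiv (P (n + 1)) * pderiv (P n)
       + P (n + 1) * pderiv (pderiv (P n))
       + of_nat n * pderiv (P (n + 1)) * P n
       - of_nat (n + 1) * P (n + 1) * pderiv (P n) = 0) \<and>
    (\<forall>n\<ge>1. \<forall>x::real.
       poly (P n) x = c_const n * exp (- (real n * (real n - 1) * x / 2)) * wronskian n omega x)"
proof (intro exI conjI allI impI)
  \<comment> \<open>\<open>c_const n\<close> is the reciprocal of the Vandermonde determinant of 0,
    ..., n - 1, which makes \<open>P n\<close> monic. The equation survives the scaling because it
    is linear in each of the two polynomials.\<close>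
  define P where "P n = smult (c_const n) (entry_det n)" for n
  have c: "c_const n \<noteq> 0" for n
    by (auto simp: c_const_def)
  show "degree (P n) = n" for n
    by (simp add: P_def c degree_entry_det)
  have "c_const 1 = 1"
    by (simp add: c_const_def)
  then show "P 1 = [:0, 1:]"
    by (simp only: P_def entry_det_1 smult_1_left)
  have "c_const 2 = 1"
    by (simp add: c_const_def)
  then show "P 2 = [:2, -2, 1:]"
    by (simp only: P_def entry_det_2 smult_1_left)
  show "pderiv (pderiv (P (n + 1))) * P n - 2 * pderiv (P (n + 1)) * pderiv (P n)
      + P (n + 1) * pderiv (pderiv (P n)) + of_nat n * pderiv (P (n + 1)) * P n
      - of_nat (n + 1) * P (n + 1) * pderiv (P n) = 0" (is "?B = 0") for n
  proof -
    have "?B = smult (c_const (n + 1) * c_const n)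
      (pderiv (pderiv (entry_det (n + 1))) * entry_det n
        - 2 * pderiv (entry_det (n + 1)) * pderiv (entry_det n)
        + entry_det (n + 1) * pderiv (pderiv (entry_det n))
        + of_nat n * pderiv (entry_det (n + 1)) * entry_det n
        - of_nat (n + 1) * entry_det (n + 1) * pderiv (entry_det n))"
      by (simp only: P_def pderiv_smult mult_smult_left mult_smult_right smult_smult
          smult_diff_right smult_add_right mult.commute[of "c_const n"])
    then show ?thesis
      by (simp only: bilinear_entry_det smult_0_right)
  qed
  show "poly (P n) x = c_const n * exp (- (real n * (real n - 1) * x / 2)) * wronskian n omega x" for n x
    by (simp add: P_def wronskian_omega exp_minus)
qed

end
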